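(* Let $A$ be an $n\times n$ complex generalized Cartan matrix such that the graph $\Gamma(A)$ is a tree, and for a nonzero complex number $q$ with a chosen square root $\sqrt q$ let $A(q) = qL+U$ be its $q$-deformation. Then: (i) The eigenvalues of $A(q)$ are the numbers of the form $$\lambda(q) = 1 + (\lambda-2)\sqrt{q} + q,$$ where $\lambda$ is an eigenvalue of $A$. (ii) There exist integers $k_1,\dots,k_n$ (depending only on $A$) such that if $x = (x_1,\dots,x_n)$ is an eigenvector of $A$ for the eigenvalue $\lambda$, then $$x(q) = (q^{k_1/2}x_1,\dots,q^{k_n/2}x_n)$$ is an eigenvector of $A(q)$ for the eigenvalue $\lambda(q) = 1 + (\lambda-2)\sqrt{q}+q$.
   Context: An $n\times n$ complex matrix $A=(a_{ij})$ is a generalized Cartan matrix if (1) for all $i\ne j$, $a_{ij}\neq 0$ implies $a_{ji}\ne 0$, and (2) $a_{ii}=2$ for all $i$. $\Gamma(A)$ is the unoriented graph with vertices $1,\dots,n$ in which two distinct vertices $i,j$ are joined by an edge iff $a_{ij}\neq 0$. A tree is a connected graph without cycles. For a generalized Cartan matrix $A$ there is a unique decomposition $A = L+U$ with $L$ lower triangular and $U$ upper triangular, both with $1$'s on the diagonal. The $q$-deformed Cartan matrix is $A(q) := qL+U$; so $A(q)_{ii}=1+q$, $A(q)_{ij}=a_{ij}$ for $i<j$ and $A(q)_{ij}=qa_{ij}$ for $i>j$. Here $q^{k/2} := (\sqrt q)^k$ for $k\in\mathbb{Z}$. Matrices act on column vectors. *)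

theory Defs
  imports
    Complex_Main
    "Jordan_Normal_Form.Char_Poly"
    "Graph_Theory.Digraph_Component"
    "Graph_Theory.Pair_Digraph"
begin

text \<open>Rows, columns and vertices are numbered \<open>0, \<dots>, n - 1\<close>.\<close>

definition generalized_cartan_matrix :: "nat \<Rightarrow> complex mat \<Rightarrow> bool" where
  "generalized_cartan_matrix n A \<longleftrightarrow>
     A \<in> carrier_mat n n \<and>
     (\<forall>i<n. \<forall>j<n. i \<noteq> j \<longrightarrow> A $$ (i, j) \<noteq> 0 \<longrightarrow> A $$ (j, i) \<noteq> 0) \<and>
     (\<forall>i<n. A $$ (i, i) = 2)"

text \<open>
  An unoriented simple graph is represented by a symmetric loop-free digraph: the edge
  \<open>{i, j}\<close> becomes the two arcs \<open>(i, j)\<close> and \<open>(j, i)\<close>. For a generalized Cartan matrix the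
  arc set below is symmetric.
\<close>

definition cartan_graph :: "complex mat \<Rightarrow> nat pair_pre_digraph" where
  "cartan_graph A =
     \<lparr> pverts = {..<dim_row A},
       parcs = {(i, j). i < dim_row A \<and> j < dim_row A \<and> i \<noteq> j \<and> A $$ (i, j) \<noteq> 0} \<rparr>"

text \<open>
  The predicate \<^const>\<open>Digraph_Component.tree\<close> of the graph library is not the right one here: it forbids all
  directed cycles, including the cycle \<open>i, j, i\<close> that every edge of a symmetric digraph gives
  rise to. The cycles of the unoriented graph are the directed cycles of length at least 3.
  Note that \<^const>\<open>Digraph_Component.connected\<close> includes that the vertex set is nonempty.
\<close>

definition unoriented_tree :: "'a pair_pre_digraph \<Rightarrow> bool" where
  "unoriented_tree G \<longleftrightarrow>
     Digraph_Component.connected (with_proj G) \<and>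
     \<not> (\<exists>p. pre_digraph.cycle (with_proj G) p \<and> length p \<ge> 3)"

definition unit_lower :: "complex mat \<Rightarrow> complex mat" where
  "unit_lower A = mat (dim_row A) (dim_col A)
     (\<lambda>(i, j). if i = j then 1 else if j < i then A $$ (i, j) else 0)"

definition unit_upper :: "complex mat \<Rightarrow> complex mat" where
  "unit_upper A = mat (dim_row A) (dim_col A)
     (\<lambda>(i, j). if i = j then 1 else if i < j then A $$ (i, j) else 0)"

definition q_cartan :: "complex \<Rightarrow> complex mat \<Rightarrow> complex mat" where
  "q_cartan q A = q \<cdot>\<^sub>m unit_lower A + unit_upper A"

lemma unit_lower_upper_decomposition:
  assumes "generalized_cartan_matrix n A"
  shows "A = unit_lower A + unit_upper A"
  using assms
  by (intro eq_matI) (auto simp: generalized_cartan_matrix_def unit_lower_def unit_upper_def)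

lemma unit_lower_upper_unique:
  assumes "L \<in> carrier_mat n n" "U \<in> carrier_mat n n" "A = L + U"
    and "\<And>i j. i < j \<Longrightarrow> j < n \<Longrightarrow> L $$ (i, j) = 0"
    and "\<And>i j. j < i \<Longrightarrow> i < n \<Longrightarrow> U $$ (i, j) = 0"
    and "\<And>i. i < n \<Longrightarrow> L $$ (i, i) = 1" "\<And>i. i < n \<Longrightarrow> U $$ (i, i) = 1"
  shows "L = unit_lower A" "U = unit_upper A"
  using assms
  by (intro eq_matI; auto simp: unit_lower_def unit_upper_def)+

lemma q_cartan_index:
  assumes "generalized_cartan_matrix n A" "i < n" "j < n"
  shows "q_cartan q A $$ (i, j) =
    (if i = j then 1 + q else if i < j then A $$ (i, j) else q * A $$ (i, j))"
  using assms
  by (auto simp: generalized_cartan_matrix_def q_cartan_def unit_lower_def unit_upper_def)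

end

theory Submission
  imports Defs
begin

text \<open>
  On a tree, orienting every edge from its smaller to its larger end yields a height function
  \<open>k\<close> on the vertices with \<open>k j = k i + 1\<close> for every edge with \<open>i < j\<close>: the signed length of a
  walk only depends on its ends. With \<open>D = diag (s ^ k i)\<close> and \<open>s\<^sup>2 = q\<close> one gets
  \<open>D\<^sup>-\<^sup>1 A(q) D = (1 + q - 2 s) I + s A\<close>, from which both claims are read off.
\<close>

context wf_digraph
begin

text \<open>Induction on length: a closed walk that is not a cycle revisits a vertex, and cutting
  there yields two strictly shorter closed walks whose weights add up to the original one, as the
  group is abelian.\<close>

lemma closed_awalk_sum_eq_0:
  fixes w :: "'b \<Rightarrow> 'c :: ab_group_add"
  assumes cyc: "\<And>c. cycle c \<Longrightarrow> sum_list (map w c) = 0"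
    and "awalk u p u"
  shows "sum_list (map w p) = 0"
  using assms(2)
proof (induction p arbitrary: u rule: length_induct)
  case (1 p)
  show ?case
  proof (cases p)
    case Nil
    then show ?thesis by simp
  next
    case (Cons e es)
    then have e: "e \<in> arcs G" "tail G e = u" and es: "awalk (head G e) es u"
      using 1(2) by (auto simp: awalk_Cons_iff)
    show ?thesis
    \<comment> \<open>These are the vertices of \<open>p\<close> without the starting one, so
      distinctness is exactly what \<open>cycle\<close> asks of \<open>p\<close>.\<close>
    proof (cases "distinct (awalk_verts (head G e) es)")
      case True
      then have "cycle p"
        using 1(2) Cons by (auto simp: cycle_def)
      then show ?thesis by (rule cyc)
    next
      case False
      then obtain q r t v where qrt: "es = q @ r @ t" "r \<noteq> []"
        "awalk (head G e) q v" "awalk v r v" "awalk v t u"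
        using awalk_not_distinct_decomp[OF es] by auto
      have "awalk u (e # q @ t) u"
        using qrt e by (auto simp: awalk_Cons_iff intro: awalk_appendI)
      moreover have "length (e # q @ t) < length p" "length r < length p"
        using qrt(1,2) Cons by auto
      ultimately have "sum_list (map w (e # q @ t)) = 0" "sum_list (map w r) = 0"
        using 1(1) qrt(4) by blast+
      then show ?thesis
        using Cons qrt(1) by (simp add: algebra_simps)
    qed
  qed
qed

text \<open>The potential of a vertex is the weight of a chosen walk to it from a fixed root. The
  choice is harmless: two walks with the same ends become closed when followed by the same return
  walk, so their weights agree.\<close>

lemma strongly_connected_potential:
  fixes w :: "'b \<Rightarrow> 'c :: ab_group_add"
  assumes cyc: "\<And>c. cycle c \<Longrightarrow> sum_list (map w c) = 0"
    and conn: "strongly_connected G"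
  obtains k where "\<And>e. e \<in> arcs G \<Longrightarrow> k (head G e) = k (tail G e) + w e"
proof -
  obtain r where r: "r \<in> verts G"
    using conn by (auto simp: strongly_connected_def)
  have walks: "\<exists>p. awalk u p v" if "u \<in> verts G" "v \<in> verts G" for u v
    using conn that by (auto simp: strongly_connected_def reachable_awalk)
  define P where "P v = (SOME p. awalk r p v)" for v
  have P: "awalk r (P v) v" if "v \<in> verts G" for v
    unfolding P_def using walks[OF r that] by (rule someI_ex)
  show ?thesis
  proof (rule that[of "\<lambda>v. sum_list (map w (P v))"])
    fix e assume e: "e \<in> arcs G"
    define x y where "x = tail G e" and "y = head G e"
    have xy: "x \<in> verts G" "y \<in> verts G" using e by (auto simp: x_def y_def)
    obtain b where b: "awalk y b r" using walks[OF xy(2) r] by blast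
    \<comment> \<open>Two walks from \<open>r\<close> to \<open>y\<close> are compared,
      \<open>P x\<close> extended by \<open>e\<close> and \<open>P y\<close>; both are closed up by
      \<open>b\<close>.\<close>
    have "awalk x (e # b) r"
      using e b by (auto simp: awalk_Cons_iff x_def y_def)
    then have "awalk r (P x @ e # b) r"
      using P[OF xy(1)] by (rule awalk_appendI[rotated])
    then have "sum_list (map w (P x @ e # b)) = 0"
      by (rule closed_awalk_sum_eq_0[rotated]) (rule cyc)
    moreover have "sum_list (map w (P y @ b)) = 0"
      by (rule closed_awalk_sum_eq_0[OF _ awalk_appendI[OF P[OF xy(2)] b]]) (rule cyc)
    ultimately have "sum_list (map w (P y)) + sum_list (map w b)
        = (sum_list (map w (P x)) + w e) + sum_list (map w b)"
      by (simp add: algebra_simps)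
    then show "sum_list (map w (P y)) = sum_list (map w (P x)) + w e"
      by simp
  qed
qed

end

text \<open>A directed cycle in a tree has length at most 2. As there are no loops, it runs along
  one edge and back, and antisymmetry makes its weight vanish.\<close>

lemma unoriented_tree_potential:
  fixes w :: "'a \<times> 'a \<Rightarrow> 'c :: ab_group_add"
  assumes "pair_bidirected_digraph G" and tree: "unoriented_tree G"
    and anti: "\<And>u v. (u, v) \<in> parcs G \<Longrightarrow> w (v, u) = - w (u, v)"
  obtains k where "\<And>u v. (u, v) \<in> parcs G \<Longrightarrow> k v = k u + w (u, v)"
proof -
  interpret pair_bidirected_digraph G by fact
  have "sum_list (map w c) = 0" if c: "cycle c" for c
  proof -
    obtain u where u: "awalk u c u" "c \<noteq> []" using c by (auto simp: cycle_def)
    have "length c < 3" using tree c by (auto simp: unoriented_tree_def)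
    with u(2) consider e where "c = [e]" | e f where "c = [e, f]"
      by (cases c; cases "tl c"; cases "tl (tl c)") auto
    then show ?thesis
    proof cases
      case 1
      then show ?thesis using u no_loops[of e] by (auto simp: awalk_Cons_iff awalk_empty_ends)
    next
      case 2
      with u have "e \<in> parcs G" "f = (snd e, fst e)"
        by (auto simp: awalk_Cons_iff prod_eq_iff)
      then show ?thesis using anti[of "fst e" "snd e"] 2 by simp
    qed
  qed
  \<comment> \<open>Connectedness ignores the direction of arcs; symmetry of the arc set turns it
    into the existence of directed walks.\<close>
  moreover have "strongly_connected (with_proj G)"
    using tree sym_arcs by (auto simp: unoriented_tree_def intro: symmetric_connected_imp_strongly_connected)
  ultimately obtain k where
    k: "\<And>e. e \<in> parcs G \<Longrightarrow> k (snd e) = k (fst e) + w e"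
    using strongly_connected_potential[of w] by auto
  have "k v = k u + w (u, v)" if "(u, v) \<in> parcs G" for u v
    using k[of "(u, v)"] that by simp
  then show ?thesis by (rule that)
qed

lemma pair_bidirected_cartan_graph:
  assumes "generalized_cartan_matrix n A"
  shows "pair_bidirected_digraph (cartan_graph A)"
  using assms
  by unfold_locales (auto simp: generalized_cartan_matrix_def cartan_graph_def symmetric_def intro!: symI)

text \<open>The disjunction lets the condition be applied directly to a nonzero entry on either side
  of the diagonal.\<close>

definition cartan_height :: "nat \<Rightarrow> complex mat \<Rightarrow> (nat \<Rightarrow> int) \<Rightarrow> bool" where
  "cartan_height n A k \<longleftrightarrow>
     (\<forall>i j. i < j \<longrightarrow> j < n \<longrightarrow> A $$ (i, j) \<noteq> 0 \<or> A $$ (j, i) \<noteq> 0 \<longrightarrow> k j = k i + 1)"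

lemma cartan_tree_height:
  assumes A: "generalized_cartan_matrix n A" and tree: "unoriented_tree (cartan_graph A)"
  obtains k where "cartan_height n A k"
proof -
  \<comment> \<open>Summed along a walk, \<open>w\<close> counts ascents minus descents.\<close>
  define w :: "nat \<times> nat \<Rightarrow> int" where "w = (\<lambda>(i, j). if i < j then 1 else - 1)"
  have "w (j, i) = - w (i, j)" if "(i, j) \<in> parcs (cartan_graph A)" for i j
    using that by (auto simp: w_def cartan_graph_def)
  then obtain k where k: "\<And>i j. (i, j) \<in> parcs (cartan_graph A) \<Longrightarrow> k j = k i + w (i, j)"
    using unoriented_tree_potential[OF pair_bidirected_cartan_graph[OF A] tree, of w] by blast
  have dim: "dim_row A = n" using A by (auto simp: generalized_cartan_matrix_def)
  have "k j = k i + 1" if "i < j" "j < n" "A $$ (i, j) \<noteq> 0 \<or> A $$ (j, i) \<noteq> 0" for i j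
  proof -
    have "A $$ (i, j) \<noteq> 0"
      using A that less_trans[OF that(1,2)] unfolding generalized_cartan_matrix_def
      by (metis less_irrefl)
    then show ?thesis
      using that(1,2) k[of i j] by (simp add: w_def cartan_graph_def dim)
  qed
  then have "cartan_height n A k" unfolding cartan_height_def by blast
  then show ?thesis by (rule that)
qed

text \<open>This is \<open>A(q) D = D (s A + (1 + q - 2 s) I)\<close> entry by entry. Above the
  diagonal the height step supplies the factor \<open>s\<close>; below it the step costs one
  \<open>s\<close> out of \<open>q = s * s\<close>, leaving \<open>s\<close> again.\<close>

lemma q_cartan_rescale_index:
  fixes k :: "nat \<Rightarrow> int"
  assumes A: "generalized_cartan_matrix n A"
    and k: "cartan_height n A k"
    and s: "s \<noteq> 0" "s\<^sup>2 = q" and ij: "i < n" "j < n"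
  shows "q_cartan q A $$ (i, j) * s powi k j =
    s powi k i * (s * A $$ (i, j) + (if i = j then 1 + q - 2 * s else 0))"
proof -
  consider "i = j" | "i < j" | "j < i" by linarith
  then show ?thesis
  proof cases
    case 1
    then show ?thesis
      using A ij by (simp add: q_cartan_index[OF A] generalized_cartan_matrix_def algebra_simps)
  next
    case 2
    then have "k j = k i + 1" if "A $$ (i, j) \<noteq> 0"
      using k ij that unfolding cartan_height_def by blast
    with 2 ij s(1) show ?thesis
      by (cases "A $$ (i, j) = 0") (simp_all add: q_cartan_index[OF A] power_int_add)
  next
    case 3
    then have "k i = k j + 1" if "A $$ (i, j) \<noteq> 0"
      using k ij that unfolding cartan_height_def by blast
    with 3 ij s(1) show ?thesis
      by (cases "A $$ (i, j) = 0")
        (simp_all add: q_cartan_index[OF A] power_int_add power2_eq_square flip: s(2))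
  qed
qed

text \<open>Since \<open>D\<close> is invertible and \<open>s\<close> is nonzero, the matrix
  identity transfers eigenvectors both ways. The backward direction gives (ii), the forward one the
  harder inclusion of (i).\<close>

lemma eigenvector_q_cartan_rescale_iff:
  fixes k :: "nat \<Rightarrow> int"
  assumes A: "generalized_cartan_matrix n A"
    and k: "cartan_height n A k"
    and s: "s \<noteq> 0" "s\<^sup>2 = q" and x: "x \<in> carrier_vec n"
  shows "eigenvector (q_cartan q A) (vec n (\<lambda>i. s powi k i * x $ i)) (1 + (\<nu> - 2) * s + q)
    \<longleftrightarrow> eigenvector A x \<nu>"
proof -
  define y where "y = vec n (\<lambda>i. s powi k i * x $ i)"
  have cA: "A \<in> carrier_mat n n" using A by (simp add: generalized_cartan_matrix_def)
  have cQ: "q_cartan q A \<in> carrier_mat n n"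
    using cA by (auto simp: q_cartan_def unit_lower_def unit_upper_def)
  have row: "(q_cartan q A *\<^sub>v y) $ i = s powi k i * (s * (A *\<^sub>v x) $ i + (1 + q - 2 * s) * x $ i)"
    if i: "i < n" for i
  proof -
    have "(q_cartan q A *\<^sub>v y) $ i = (\<Sum>j<n. q_cartan q A $$ (i, j) * s powi k j * x $ j)"
      using i cQ by (simp add: y_def scalar_prod_def atLeast0LessThan mult.assoc)
    also have "\<dots> = (\<Sum>j<n. s powi k i *
        (s * (A $$ (i, j) * x $ j) + (if i = j then (1 + q - 2 * s) * x $ j else 0)))"
    proof (intro sum.cong refl)
      fix j assume "j \<in> {..<n}"
      then have "j < n" by simp
      show "q_cartan q A $$ (i, j) * s powi k j * x $ j = s powi k i *
          (s * (A $$ (i, j) * x $ j) + (if i = j then (1 + q - 2 * s) * x $ j else 0))"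
        unfolding q_cartan_rescale_index[OF A k s i \<open>j < n\<close>] by (simp add: distrib_right)
    qed
    also have "\<dots> = s powi k i * (s * (\<Sum>j<n. A $$ (i, j) * x $ j) + (1 + q - 2 * s) * x $ i)"
      using i by (simp add: sum.distrib flip: sum_distrib_left)
    also have "(\<Sum>j<n. A $$ (i, j) * x $ j) = (A *\<^sub>v x) $ i"
      using i cA x by (simp add: scalar_prod_def atLeast0LessThan)
    finally show ?thesis .
  qed
  have "(q_cartan q A *\<^sub>v y) $ i = ((1 + (\<nu> - 2) * s + q) \<cdot>\<^sub>v y) $ i
      \<longleftrightarrow> (A *\<^sub>v x) $ i = (\<nu> \<cdot>\<^sub>v x) $ i" if i: "i < n" for i
  proof -
    have "((1 + (\<nu> - 2) * s + q) \<cdot>\<^sub>v y) $ i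
        = s powi k i * (s * (\<nu> \<cdot>\<^sub>v x) $ i + (1 + q - 2 * s) * x $ i)"
      using i x by (simp add: y_def algebra_simps)
    \<comment> \<open>Both sides now have the factor \<open>s powi k i\<close> and the same multiple
      of \<open>x $ i\<close>; cancelling these and then \<open>s\<close> leaves the equation for
      \<open>A\<close>.\<close>
    then show ?thesis using s(1) by (simp only: row[OF i]) simp
  qed
  then have "q_cartan q A *\<^sub>v y = (1 + (\<nu> - 2) * s + q) \<cdot>\<^sub>v y \<longleftrightarrow> A *\<^sub>v x = \<nu> \<cdot>\<^sub>v x"
    using cA cQ x by (auto simp: vec_eq_iff y_def)
  moreover have "y = 0\<^sub>v n \<longleftrightarrow> x = 0\<^sub>v n"
    using s(1) x by (auto simp: vec_eq_iff y_def)
  ultimately show ?thesis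
    using cA cQ x by (auto simp: eigenvector_def y_def[symmetric]) (auto simp: y_def)
qed

theorem theorem4:
  fixes n :: nat and A :: "complex mat"
  assumes "generalized_cartan_matrix n A"
    and "unoriented_tree (cartan_graph A)"
  shows "(\<forall>q s :: complex. q \<noteq> 0 \<longrightarrow> s\<^sup>2 = q \<longrightarrow>
            {\<mu>. eigenvalue (q_cartan q A) \<mu>} = {1 + (\<nu> - 2) * s + q | \<nu>. eigenvalue A \<nu>}) \<and>
         (\<exists>k :: nat \<Rightarrow> int. \<forall>q s :: complex. q \<noteq> 0 \<longrightarrow> s\<^sup>2 = q \<longrightarrow>
            (\<forall>\<nu> x. eigenvector A x \<nu> \<longrightarrow>
               eigenvector (q_cartan q A) (vec n (\<lambda>i. s powi (k i) * x $ i))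
                 (1 + (\<nu> - 2) * s + q)))"
proof -
  \<comment> \<open>The exponents are fixed before \<open>q\<close> and \<open>s\<close> appear, so
    they depend on \<open>A\<close> alone.\<close>
  obtain k where k: "cartan_height n A k"
    using cartan_tree_height[OF assms] by blast
  note iff = eigenvector_q_cartan_rescale_iff[OF assms(1) k]
  have dim: "dim_row A = n" "dim_row (q_cartan q A) = n" for q
    using assms(1)
    by (auto simp: generalized_cartan_matrix_def q_cartan_def unit_lower_def unit_upper_def)
  have ev: "eigenvector (q_cartan q A) (vec n (\<lambda>i. s powi k i * x $ i)) (1 + (\<nu> - 2) * s + q)"
    if "q \<noteq> 0" "s\<^sup>2 = q" "eigenvector A x \<nu>" for q s \<nu> x
  proof -
    have "s \<noteq> 0" using that by auto
    moreover have "x \<in> carrier_vec n" using that(3) by (simp add: eigenvector_def dim)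
    ultimately show ?thesis using iff that(2,3) by blast
  qed
  have "\<exists>\<nu>. \<mu> = 1 + (\<nu> - 2) * s + q \<and> eigenvalue A \<nu>"
    if qs: "q \<noteq> 0" "s\<^sup>2 = q" and \<mu>: "eigenvalue (q_cartan q A) \<mu>" for q s \<mu>
  proof -
    have s: "s \<noteq> 0" using qs by auto
    obtain y where y: "eigenvector (q_cartan q A) y \<mu>"
      using \<mu> by (auto simp: eigenvalue_def)
    \<comment> \<open>Undo the rescaling of \<open>y\<close>, and solve
      \<open>\<mu> = 1 + (\<nu> - 2) * s + q\<close> for \<open>\<nu>\<close>.\<close>
    define x where "x = vec n (\<lambda>i. s powi (- k i) * y $ i)"
    define \<nu> where "\<nu> = 2 + (\<mu> - 1 - q) / s"
    have "y = vec n (\<lambda>i. s powi k i * x $ i)"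
      using y s by (auto simp: x_def vec_eq_iff eigenvector_def dim power_int_minus)
    moreover have \<mu>\<nu>: "\<mu> = 1 + (\<nu> - 2) * s + q"
      using s by (simp add: \<nu>_def)
    ultimately have "eigenvector A x \<nu>"
      using y iff[OF s qs(2), of x \<nu>] by (simp add: x_def)
    with \<mu>\<nu> show ?thesis by (auto simp: eigenvalue_def)
  qed
  moreover have "eigenvalue (q_cartan q A) (1 + (\<nu> - 2) * s + q)"
    if "q \<noteq> 0" "s\<^sup>2 = q" "eigenvalue A \<nu>" for q s \<nu>
    using ev[OF that(1,2)] that(3) by (auto simp: eigenvalue_def)
  ultimately show ?thesis using ev by blast
qed

end
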